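(* Let $d\geq 2$. Then $\mathcal{H}(d)$ has the weak topological Rohlin property; that is, there is an action $\varphi\in\mathcal{H}(d)$ whose conjugacy class $[\varphi]$ is dense in $\mathcal{H}(d)$.
   Context: $K$ is the Cantor set and $\mathcal{H}=\mathrm{homeo}(K)$ is the Polish group of homeomorphisms of $K$ with the topology of uniform convergence. $\mathcal{H}(d)=\mathrm{Hom}(\mathbb{Z}^{d},\mathcal{H})$ is the space of continuous $\mathbb{Z}^{d}$-actions $\varphi=\{\varphi^{u}\}_{u\in\mathbb{Z}^{d}}$ on $K$, with the Polish topology inherited as a closed subset of the product $\mathcal{H}^{\mathbb{Z}^{d}}$. The conjugacy class of $\varphi$ is $[\varphi]=\{\{\pi\varphi^{u}\pi^{-1}\}_{u\in\mathbb{Z}^{d}} : \pi\in\mathcal{H}\}$. *)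

theory Defs
  imports "HOL-Analysis.Analysis"
begin

text \<open>The middle-thirds set: reals with a ternary expansion using only the digits 0 and 2.\<close>

definition cantor_set :: "real set" where
  "cantor_set = {x. \<exists>a. (\<forall>n. a n \<in> {0, 2}) \<and> (\<lambda>n. a n / 3 ^ Suc n) sums x}"

text \<open>
  Homeomorphisms of \<open>K\<close> are functions on the ambient type that are made \<^const>\<open>undefined\<close>
  outside \<open>K\<close>, so that they are determined by their values on \<open>K\<close>.
\<close>

definition homeos :: "'a::metric_space set \<Rightarrow> ('a \<Rightarrow> 'a) set" where
  "homeos K = {f \<in> extensional K. homeomorphic_map (top_of_set K) (top_of_set K) f}"

definition homeo_inv :: "'a set \<Rightarrow> ('a \<Rightarrow> 'a) \<Rightarrow> 'a \<Rightarrow> 'a" where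
  "homeo_inv K f = restrict (inv_into K f) K"

text \<open>
  \<^const>\<open>cfunspace\<close> carries the supremum metric on bounded continuous functions;
  it contains all of \<open>homeos K\<close> when \<open>K\<close> is compact.
\<close>

definition homeo_topology :: "'a::metric_space set \<Rightarrow> ('a \<Rightarrow> 'a) topology" where
  "homeo_topology K =
     subtopology (mtopology_of (cfunspace (top_of_set K) (submetric euclidean_metric K)))
       (homeos K)"

text \<open>
  The group homomorphisms from the discrete additive group \<open>'g\<close> to the group of homeomorphisms
  of \<open>K\<close> under composition.
\<close>

definition actions :: "'a::metric_space set \<Rightarrow> ('g::ab_group_add \<Rightarrow> 'a \<Rightarrow> 'a) set" where
  "actions K = {\<phi>. (\<forall>u. \<phi> u \<in> homeos K) \<and> (\<forall>u v. \<phi> (u + v) = compose K (\<phi> u) (\<phi> v))}"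

definition action_topology ::
    "'a::metric_space set \<Rightarrow> ('g::ab_group_add \<Rightarrow> 'a \<Rightarrow> 'a) topology" where
  "action_topology K =
     subtopology (product_topology (\<lambda>_. homeo_topology K) UNIV) (actions K)"

definition conjugacy_class ::
    "'a::metric_space set \<Rightarrow> ('g::ab_group_add \<Rightarrow> 'a \<Rightarrow> 'a) \<Rightarrow> ('g \<Rightarrow> 'a \<Rightarrow> 'a) set" where
  "conjugacy_class K \<phi> =
     {\<lambda>u. compose K \<pi> (compose K (\<phi> u) (homeo_inv K \<pi>)) | \<pi>. \<pi> \<in> homeos K}"

text \<open>The type argument only selects the acting group \<open>'g\<close>.\<close>

definition weak_topological_Rohlin ::
    "'a::metric_space set \<Rightarrow> 'g::ab_group_add itself \<Rightarrow> bool" where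
  "weak_topological_Rohlin K _ \<longleftrightarrow>
     (\<exists>\<phi> \<in> (actions K :: ('g \<Rightarrow> 'a \<Rightarrow> 'a) set).
        action_topology K closure_of conjugacy_class K \<phi> = actions K)"

end

theory Submission
  imports Defs
begin

text \<open>
  The dense conjugacy class is that of a countable product action. Points of the Cantor set \<open>K\<close>
  are coded by binary sequences, and \<open>nat \<times> nat \<cong> nat\<close> splits one sequence into
  countably many, which identifies \<open>K\<close> with \<open>K\<close> to the power \<open>nat\<close>. Through this
  identification a sequence of actions \<open>\<Phi> k\<close> is merged into a single action of which each
  \<open>\<Phi> k\<close> is a factor via a coordinate projection (\<open>product_action_in_actions\<close>,
  \<open>proj_product_action\<close>).

  A factor map becomes a conjugacy at the cost of an arbitrarily small error: the first \<open>n\<close>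
  digits of the \<open>k\<close>-th projection of \<open>z\<close> are \<open>n\<close> of the digits of \<open>z\<close>, so a
  permutation of the digit positions which moves these to the front is a homeomorphism \<open>\<pi>\<close>
  of \<open>K\<close> that is uniformly close to the projection (\<open>relabel_agrees_with_proj\<close>). Conjugating the
  product by \<open>\<pi>\<close> therefore brings it close to \<open>\<Phi> k\<close>.

  It remains to choose the \<open>\<Phi> k\<close> so that they come close to every action. For a finite set
  \<open>F\<close> of group elements and a precision \<open>n\<close>, record for \<open>u \<in> F\<close> which cylinders of
  length \<open>n\<close> meet the image under \<open>u\<close> of which other such cylinders. Actions with the same
  record for large \<open>n\<close> are uniformly close on \<open>F\<close>, and over a countable group there are only
  countably many records, so countably many actions realise all records that occur
  (\<open>countable_pattern_representatives\<close>). The argument applies to every countable abelian group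
  and every metric space homeomorphic to the space of binary sequences; the ternary expansion
  shows that the middle-thirds set is such a space.
\<close>

section \<open>Homeomorphisms, actions and conjugates\<close>

lemma homeosI:
  assumes "homeomorphism K K f g" "f \<in> extensional K"
  shows "f \<in> homeos K"
proof -
  have "homeomorphic_maps (top_of_set K) (top_of_set K) f g"
    using assms(1) by (auto simp: homeomorphic_maps_def homeomorphism_def)
  then show ?thesis
    using assms(2) by (auto simp: homeos_def homeomorphic_map_maps)
qed

lemma homeomorphism_homeo_inv:
  assumes "f \<in> homeos K"
  shows "homeomorphism K K f (homeo_inv K f)"
proof -
  obtain g where "homeomorphic_maps (top_of_set K) (top_of_set K) f g"
    using assms by (auto simp: homeos_def homeomorphic_map_maps)
  then have cont: "continuous_on K f" "continuous_on K g" "f ` K \<subseteq> K" "g ` K \<subseteq> K"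
    and inv: "\<And>x. x \<in> K \<Longrightarrow> g (f x) = x" "\<And>x. x \<in> K \<Longrightarrow> f (g x) = x"
    by (auto simp: homeomorphic_maps_def)
  have "homeo_inv K f y = g y" if "y \<in> K" for y
  proof -
    have "inj_on f K" using inv(1) by (metis inj_onI)
    then show ?thesis
      using inv(2)[OF that] cont(4) that by (auto simp: homeo_inv_def intro!: inv_into_f_eq)
  qed
  moreover have "homeomorphism K K f g"
    using cont inv by (intro homeomorphismI) auto
  ultimately show ?thesis
    using homeomorphism_cong by fastforce
qed

lemma homeo_inv_in_homeos:
  assumes "f \<in> homeos K"
  shows "homeo_inv K f \<in> homeos K"
proof (rule homeosI)
  show "homeomorphism K K (homeo_inv K f) f"
    using homeomorphism_homeo_inv[OF assms] homeomorphism_symD by blast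
qed (simp add: homeo_inv_def)

lemma compose_in_homeos:
  assumes "f \<in> homeos K" "g \<in> homeos K"
  shows "compose K f g \<in> homeos K"
proof (rule homeosI)
  have "homeomorphism K K (f \<circ> g) (homeo_inv K g \<circ> homeo_inv K f)"
    using assms homeomorphism_compose homeomorphism_homeo_inv by metis
  then show "homeomorphism K K (compose K f g) (homeo_inv K g \<circ> homeo_inv K f)"
    by (rule homeomorphism_cong) (auto simp: compose_def)
qed simp

lemma homeo_props:
  assumes "f \<in> homeos K"
  shows "continuous_on K f" and "\<And>x. x \<in> K \<Longrightarrow> f x \<in> K"
    and "\<And>x. x \<in> K \<Longrightarrow> homeo_inv K f x \<in> K"
    and "\<And>x. x \<in> K \<Longrightarrow> homeo_inv K f (f x) = x"
    and "\<And>x. x \<in> K \<Longrightarrow> f (homeo_inv K f x) = x"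
    and "f \<in> extensional K"
  using homeomorphism_homeo_inv[OF assms] assms by (auto simp: homeomorphism_def homeos_def)

lemma action_homeos: "\<phi> \<in> actions K \<Longrightarrow> \<phi> u \<in> homeos K"
  by (auto simp: actions_def)

lemma action_add: "\<phi> \<in> actions K \<Longrightarrow> x \<in> K \<Longrightarrow> \<phi> (u + v) x = \<phi> u (\<phi> v x)"
  by (simp add: actions_def compose_def)

text \<open>The idempotent \<open>\<phi> 0\<close> is injective, hence the identity.\<close>

lemma action_zero:
  assumes "\<phi> \<in> actions K" "x \<in> K"
  shows "\<phi> 0 x = x"
proof -
  have "\<phi> 0 (\<phi> 0 x) = \<phi> 0 x"
    using action_add[OF assms, of 0 0] by simp
  then show ?thesis
    using homeo_props(4)[OF action_homeos[OF assms(1), of 0]] homeo_props(2)[OF action_homeos[OF assms(1)]]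
      assms(2) by metis
qed

lemma actionsI:
  assumes "\<And>u. continuous_on K (\<phi> u)" "\<And>u x. x \<in> K \<Longrightarrow> \<phi> u x \<in> K"
    and "\<And>u. \<phi> u \<in> extensional K"
    and zero: "\<And>x. x \<in> K \<Longrightarrow> \<phi> 0 x = x"
    and add: "\<And>u v x. x \<in> K \<Longrightarrow> \<phi> (u + v) x = \<phi> u (\<phi> v x)"
  shows "\<phi> \<in> actions K"
proof -
  have "homeomorphism K K (\<phi> u) (\<phi> (- u))" for u
    using assms add[of _ u "- u"] add[of _ "- u" u] by (intro homeomorphismI) auto
  then have "\<phi> u \<in> homeos K" for u
    using assms(3) by (rule homeosI)
  moreover have "\<phi> (u + v) = compose K (\<phi> u) (\<phi> v)" for u v
    by (rule extensionalityI[OF assms(3)]) (auto simp: add compose_def)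
  ultimately show ?thesis
    by (auto simp: actions_def)
qed

lemma conjugate_in_actions:
  assumes \<phi>: "\<phi> \<in> actions K" and \<pi>: "\<pi> \<in> homeos K"
  shows "(\<lambda>u. compose K \<pi> (compose K (\<phi> u) (homeo_inv K \<pi>))) \<in> actions K"
proof -
  have "compose K \<pi> (compose K (\<phi> u) (homeo_inv K \<pi>)) \<in> homeos K" for u
    by (intro compose_in_homeos action_homeos[OF \<phi>] homeo_inv_in_homeos \<pi>)
  moreover have "compose K \<pi> (compose K (\<phi> (u + v)) (homeo_inv K \<pi>)) =
      compose K (compose K \<pi> (compose K (\<phi> u) (homeo_inv K \<pi>)))
        (compose K \<pi> (compose K (\<phi> v) (homeo_inv K \<pi>)))" for u v
    using homeo_props[OF \<pi>] homeo_props(2)[OF action_homeos[OF \<phi>]]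
    by (intro extensionalityI[where A = K]) (auto simp: compose_def action_add[OF \<phi>])
  ultimately show ?thesis
    by (auto simp: actions_def)
qed

section \<open>Neighbourhoods in the space of actions\<close>

text \<open>
  The carrier of \<^const>\<open>cfunspace\<close> consists of bounded maps only, so compactness is what makes
  \<^const>\<open>homeos\<close> the full carrier of \<^const>\<open>homeo_topology\<close>.
\<close>

lemma homeos_subset_cfunspace:
  fixes K :: "'a::metric_space set"
  assumes "compact K"
  shows "homeos K \<subseteq> mspace (cfunspace (top_of_set K) (submetric euclidean_metric K))"
proof
  fix f assume f: "f \<in> homeos K"
  have *: "Metric_space K (dist :: 'a \<Rightarrow> _)"
    using Met_TC.subspace by blast
  have "f ` K = K"
    using homeomorphism_homeo_inv[OF f] by (simp add: homeomorphism_def)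
  moreover have "Metric_space.mbounded K dist K"
  proof (cases "K = {}")
    case False
    then obtain x0 where x0: "x0 \<in> K" by auto
    obtain C where "\<And>x. x \<in> K \<Longrightarrow> dist x0 x \<le> C"
      using compact_imp_bounded[OF assms] bounded_any_center[of K x0] by auto
    then show ?thesis
      using x0 unfolding Metric_space.mbounded[OF *] by blast
  qed (use * in \<open>simp add: Metric_space.mbounded_empty\<close>)
  ultimately show "f \<in> mspace (cfunspace (top_of_set K) (submetric euclidean_metric K))"
    using homeo_props[OF f] by (auto simp: mtopology_of_submetric)
qed

text \<open>
  The two neighbourhood lemmas replace the supremum metric and the product topology by pointwise
  estimates: an open set around an action contains all actions that are uniformly close to it on
  a finite set of group elements.
\<close>

lemma homeo_topology_nbhd:
  assumes K: "compact K" "K \<noteq> {}" and V: "openin (homeo_topology K) V" "f \<in> V"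
  obtains e where "e > 0"
    and "\<And>g. g \<in> homeos K \<Longrightarrow> (\<And>x. x \<in> K \<Longrightarrow> dist (f x) (g x) < e) \<Longrightarrow> g \<in> V"
proof -
  let ?m = "cfunspace (top_of_set K) (submetric euclidean_metric K)"
  interpret C: Metric_space "mspace ?m" "mdist ?m" by (rule Metric_space_mspace_mdist)
  obtain W where W: "openin (mtopology_of ?m) W" "V = W \<inter> homeos K"
    using V(1) by (auto simp: homeo_topology_def openin_subtopology)
  then obtain r where r: "r > 0" "C.mball f r \<subseteq> W"
    using V(2) unfolding mtopology_of_def C.openin_mtopology by blast
  have "g \<in> V" if g: "g \<in> homeos K" and d: "\<And>x. x \<in> K \<Longrightarrow> dist (f x) (g x) < r / 2" for g
  proof -
    \<comment> \<open>A supremum of distances below the bound may equal it, hence the bound is half the radius.\<close>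
    have "f \<in> mspace ?m" "g \<in> mspace ?m"
      using homeos_subset_cfunspace[OF K(1)] g V(2) W(2) by auto
    moreover from this have "mdist ?m f g \<le> r / 2"
      using K(2) d by (subst cfunspace_mdist_le) (auto intro: less_imp_le)
    ultimately have "g \<in> C.mball f r"
      using r(1) unfolding C.in_mball by linarith
    then show "g \<in> V" using r(2) W(2) g by auto
  qed
  then show ?thesis
    using that[of "r / 2"] r(1) by auto
qed

lemma topspace_homeo_topology:
  assumes "compact K" shows "topspace (homeo_topology K) = homeos K"
  using homeos_subset_cfunspace[OF assms] by (auto simp: homeo_topology_def)

lemma topspace_action_topology:
  assumes "compact K" shows "topspace (action_topology K) = actions K"
  using assms by (auto simp: action_topology_def topspace_homeo_topology actions_def)

lemma action_topology_nbhd: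
  assumes K: "compact K" "K \<noteq> {}" and T: "openin (action_topology K) T" "\<psi> \<in> T"
  obtains F e where "finite F" "e > 0"
    and "\<And>\<theta>. \<theta> \<in> actions K \<Longrightarrow> (\<And>u x. u \<in> F \<Longrightarrow> x \<in> K \<Longrightarrow> dist (\<psi> u x) (\<theta> u x) < e) \<Longrightarrow> \<theta> \<in> T"
proof -
  obtain U where U: "openin (product_topology (\<lambda>_. homeo_topology K) UNIV) U" "T = U \<inter> actions K"
    using T(1) by (auto simp: action_topology_def openin_subtopology)
  then obtain V where "finite {u. V u \<noteq> homeos K}" "\<forall>u. openin (homeo_topology K) (V u)"
      "\<psi> \<in> Pi\<^sub>E UNIV V" "Pi\<^sub>E UNIV V \<subseteq> U"
    using T(2) unfolding openin_product_topology_alt topspace_homeo_topology[OF K(1)] by auto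
  then have V: "finite {u. V u \<noteq> homeos K}" "\<And>u. openin (homeo_topology K) (V u)"
      "\<And>u. \<psi> u \<in> V u" "Pi UNIV V \<subseteq> U"
    by (auto simp: PiE_UNIV_domain)
  have "\<exists>e>0. \<forall>g\<in>homeos K. (\<forall>x\<in>K. dist (\<psi> u x) (g x) < e) \<longrightarrow> g \<in> V u" for u
    using homeo_topology_nbhd[OF K V(2,3), of u] by metis
  then obtain e where e: "\<And>u. e u > 0"
      "\<And>u g. g \<in> homeos K \<Longrightarrow> (\<And>x. x \<in> K \<Longrightarrow> dist (\<psi> u x) (g x) < e u) \<Longrightarrow> g \<in> V u"
    by metis
  \<comment> \<open>The 1 keeps the minimum meaningful when no coordinate is restricted.\<close>
  define F where "F = {u. V u \<noteq> homeos K}"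
  define r where "r = Min (insert 1 (e ` F))"
  have F: "finite F" using V(1) by (simp add: F_def)
  have r: "r > 0" "\<And>u. u \<in> F \<Longrightarrow> r \<le> e u"
    using F e(1) by (auto simp: r_def)
  show ?thesis
  proof (rule that[OF F r(1)])
    fix \<theta> assume \<theta>: "\<theta> \<in> actions K"
      and d: "\<And>u x. u \<in> F \<Longrightarrow> x \<in> K \<Longrightarrow> dist (\<psi> u x) (\<theta> u x) < r"
    have "\<theta> u \<in> V u" for u
    proof (cases "u \<in> F")
      case True
      then show ?thesis
        using d[OF True] r(2)[OF True] by (intro e(2) action_homeos[OF \<theta>]) force
    next
      case False
      then show ?thesis using action_homeos[OF \<theta>] by (auto simp: F_def)
    qed
    then show "\<theta> \<in> T"
      using V(4) U(2) \<theta> by auto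
  qed
qed

section \<open>Copies of the space of binary sequences\<close>

lemma compact_binary_sequences: "compact (UNIV :: (nat \<Rightarrow> bool) set)"
proof -
  have "compactin (product_topology (\<lambda>_. euclidean :: bool topology) UNIV) (UNIV \<rightarrow>\<^sub>E UNIV)"
    unfolding compactin_PiE by (auto intro: finite_imp_compact)
  then show ?thesis
    by (simp add: euclidean_product_topology)
qed

text \<open>
  Throughout, \<open>e x\<close> is the sequence of digits of the point \<open>x\<close>, and \<open>h\<close> recovers the
  point from its digits.
\<close>

locale cantor_coding =
  fixes K :: "'a::metric_space set" and h :: "(nat \<Rightarrow> bool) \<Rightarrow> 'a" and e :: "'a \<Rightarrow> nat \<Rightarrow> bool"
  assumes coding: "homeomorphism UNIV K h e"
begin

lemma eh [simp]: "e (h a) = a"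
  and he: "x \<in> K \<Longrightarrow> h (e x) = x"
  and hK [simp]: "h a \<in> K"
  and continuous_h: "continuous_on UNIV h"
  and continuous_e: "continuous_on K e"
  using coding by (auto simp: homeomorphism_def)

lemma compact_K: "compact K"
  using compact_continuous_image[OF continuous_h compact_binary_sequences] coding
  by (simp add: homeomorphism_def)

lemma K_nonempty: "K \<noteq> {}"
  using hK by blast

lemma continuous_digit: "continuous_on K (\<lambda>x. e x i)"
  using continuous_e by (rule continuous_on_product_then_coordinatewise)

lemma continuous_by_digits:
  assumes "\<And>i. continuous_on S (\<lambda>z. f z i)"
  shows "continuous_on S (\<lambda>z. h (f z))"
  using continuous_on_compose2[OF continuous_h continuous_on_coordinatewise_then_product[OF assms]]
  by simp

definition agree :: "nat \<Rightarrow> 'a \<Rightarrow> 'a \<Rightarrow> bool" where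
  "agree n x y \<longleftrightarrow> (\<forall>i<n. e x i = e y i)"

text \<open>
  If pairs sharing more and more digits stayed apart, compactness would give two limit points at
  positive distance; since each digit is locally constant, these would share all digits.
\<close>

lemma agree_imp_close:
  assumes "\<epsilon> > 0"
  obtains n where "\<And>x y. x \<in> K \<Longrightarrow> y \<in> K \<Longrightarrow> agree n x y \<Longrightarrow> dist x y < \<epsilon>"
proof (rule ccontr)
  assume "\<not> thesis"
  then have "\<forall>n. \<exists>x y. x \<in> K \<and> y \<in> K \<and> agree n x y \<and> \<not> dist x y < \<epsilon>"
    using that by blast
  then obtain X Y where XY: "\<And>n. X n \<in> K" "\<And>n. Y n \<in> K" "\<And>n. agree n (X n) (Y n)"
      "\<And>n. \<not> dist (X n) (Y n) < \<epsilon>"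
    by metis
  have seq: "seq_compact K"
    using compact_K compact_imp_seq_compact by blast
  obtain x r where x: "x \<in> K" "strict_mono r" "(X \<circ> r) \<longlonglongrightarrow> x"
    using seq XY(1) unfolding seq_compact_def by metis
  obtain y s where y: "y \<in> K" "strict_mono s" "((Y \<circ> r) \<circ> s) \<longlonglongrightarrow> y"
    using seq XY(2) unfolding seq_compact_def by (metis comp_apply)
  define t where "t = r \<circ> s"
  have t: "strict_mono t" using x(2) y(2) by (simp add: t_def strict_mono_o)
  have lim: "(\<lambda>n. X (t n)) \<longlonglongrightarrow> x" "(\<lambda>n. Y (t n)) \<longlonglongrightarrow> y"
    using LIMSEQ_subseq_LIMSEQ[OF x(3) y(2)] y(3) by (auto simp: t_def comp_def)
  have "e x i = e y i" for i
  proof -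
    have "(\<lambda>n. e (X (t n)) i) \<longlonglongrightarrow> e x i" "(\<lambda>n. e (Y (t n)) i) \<longlonglongrightarrow> e y i"
      using continuous_on_tendsto_compose[OF continuous_digit lim(1) x(1)]
        continuous_on_tendsto_compose[OF continuous_digit lim(2) y(1)] XY(1,2) by auto
    then have "\<forall>\<^sub>F n in sequentially. e (X (t n)) i = e x i"
        "\<forall>\<^sub>F n in sequentially. e (Y (t n)) i = e y i"
      by (auto simp: tendsto_discrete)
    moreover have "\<forall>\<^sub>F n in sequentially. e (X (t n)) i = e (Y (t n)) i"
      using eventually_gt_at_top[of i]
    proof eventually_elim
      case (elim n)
      then have "i < t n" using seq_suble[OF t, of n] by simp
      then show ?case using XY(3)[of "t n"] by (simp add: agree_def)
    qed
    ultimately have "\<forall>\<^sub>F n in sequentially. e x i = e y i"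
      by eventually_elim simp
    then show ?thesis by simp
  qed
  then have "e x = e y" by (rule ext)
  then have "x = y" using he[OF x(1)] he[OF y(1)] by metis
  have "(\<lambda>n. dist (X (t n)) (Y (t n))) \<longlonglongrightarrow> 0"
    using tendsto_dist[OF lim] unfolding \<open>x = y\<close> dist_self .
  then have "\<forall>\<^sub>F n in sequentially. dist (X (t n)) (Y (t n)) < \<epsilon>"
    using assms by (rule order_tendstoD(2))
  then show False
    using XY(4) by simp
qed

text \<open>
  Reading the digits in another order, even with repetitions or omissions, is continuous. The
  permutations give the
  conjugating homeomorphisms, and the sections of \<open>nat \<times> nat \<cong> nat\<close> the projections.
\<close>

definition relabel :: "(nat \<Rightarrow> nat) \<Rightarrow> 'a \<Rightarrow> 'a" where
  "relabel \<sigma> = restrict (\<lambda>z. h (\<lambda>i. e z (\<sigma> i))) K"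

lemma digit_relabel: "z \<in> K \<Longrightarrow> e (relabel \<sigma> z) i = e z (\<sigma> i)"
  by (simp add: relabel_def)

lemma relabel_in_K: "z \<in> K \<Longrightarrow> relabel \<sigma> z \<in> K"
  by (simp add: relabel_def)

lemma continuous_relabel: "continuous_on K (relabel \<sigma>)"
proof -
  have "continuous_on K (\<lambda>z. h (\<lambda>i. e z (\<sigma> i)))"
    by (intro continuous_by_digits continuous_digit)
  then show ?thesis
    by (rule continuous_on_eq) (simp add: relabel_def)
qed

lemma relabel_in_homeos:
  assumes "bij \<sigma>" shows "relabel \<sigma> \<in> homeos K"
proof (rule homeosI)
  show "homeomorphism K K (relabel \<sigma>) (relabel (inv \<sigma>))"
  proof (rule homeomorphismI)
    fix x assume x: "x \<in> K"
    show "relabel (inv \<sigma>) (relabel \<sigma> x) = x" "relabel \<sigma> (relabel (inv \<sigma>) x) = x"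
      using x assms by (auto simp: relabel_def he bij_is_inj bij_is_surj surj_f_inv_f)
  qed (auto simp: continuous_relabel relabel_in_K)
qed (simp add: relabel_def)

definition proj :: "nat \<Rightarrow> 'a \<Rightarrow> 'a" where
  "proj k = relabel (\<lambda>i. prod_encode (k, i))"

definition tuple :: "(nat \<Rightarrow> 'a) \<Rightarrow> 'a" where
  "tuple f = h (\<lambda>m. e (f (fst (prod_decode m))) (snd (prod_decode m)))"

lemma proj_in_K: "z \<in> K \<Longrightarrow> proj k z \<in> K"
  by (simp add: proj_def relabel_in_K)

lemma proj_tuple: "(\<And>k. f k \<in> K) \<Longrightarrow> proj k (tuple f) = f k"
  by (simp add: proj_def tuple_def relabel_def he)

lemma tuple_proj: "z \<in> K \<Longrightarrow> tuple (\<lambda>k. proj k z) = z"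
  by (simp add: tuple_def proj_def digit_relabel he)

text \<open>
  On \<open>K\<close> every point is the tuple of its projections, so this is the diagonal action on the
  product of countably many copies of \<open>K\<close>, carried over to \<open>K\<close>.
\<close>

definition product_action :: "(nat \<Rightarrow> 'g \<Rightarrow> 'a \<Rightarrow> 'a) \<Rightarrow> 'g \<Rightarrow> 'a \<Rightarrow> 'a" where
  "product_action \<Phi> u = restrict (\<lambda>z. tuple (\<lambda>k. \<Phi> k u (proj k z))) K"

lemma proj_product_action:
  assumes "\<And>k. \<Phi> k \<in> actions K" "z \<in> K"
  shows "proj k (product_action \<Phi> u z) = \<Phi> k u (proj k z)"
  using assms homeo_props(2)[OF action_homeos[OF assms(1)]]
  by (simp add: product_action_def proj_tuple proj_in_K)

lemma product_action_in_actions: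
  fixes \<Phi> :: "nat \<Rightarrow> 'g::ab_group_add \<Rightarrow> 'a \<Rightarrow> 'a"
  assumes \<Phi>: "\<And>k. \<Phi> k \<in> actions K"
  shows "product_action \<Phi> \<in> actions K"
proof (rule actionsI)
  have "continuous_on K (\<lambda>z. tuple (\<lambda>k. \<Phi> k u (proj k z)))" for u
    unfolding tuple_def
  proof (rule continuous_by_digits)
    fix m
    define k where "k = fst (prod_decode m)"
    have "continuous_on K (\<lambda>z. \<Phi> k u (proj k z))"
      unfolding proj_def
      by (rule continuous_on_compose2[OF homeo_props(1)[OF action_homeos[OF \<Phi>]] continuous_relabel])
        (auto simp: relabel_in_K)
    then show "continuous_on K (\<lambda>z. e (\<Phi> (fst (prod_decode m)) u (proj (fst (prod_decode m)) z))
        (snd (prod_decode m)))"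
      unfolding k_def
      by (rule continuous_on_compose2[OF continuous_digit])
        (auto simp: proj_in_K homeo_props(2)[OF action_homeos[OF \<Phi>]])
  qed
  then show "continuous_on K (product_action \<Phi> u)" for u
    by (rule continuous_on_eq) (simp add: product_action_def)
  show in_K: "product_action \<Phi> u x \<in> K" if "x \<in> K" for u x
    using that by (simp add: product_action_def tuple_def)
  show "product_action \<Phi> 0 x = x" if "x \<in> K" for x
    using that by (simp add: product_action_def action_zero[OF \<Phi>] proj_in_K tuple_proj)
  show "product_action \<Phi> (u + v) x = product_action \<Phi> u (product_action \<Phi> v x)"
    if x: "x \<in> K" for u v x
  proof -
    have "product_action \<Phi> u (product_action \<Phi> v x) =
        tuple (\<lambda>k. \<Phi> k u (proj k (product_action \<Phi> v x)))"
      using in_K[OF x, of v] by (simp add: product_action_def[of _ u])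
    also have "\<dots> = product_action \<Phi> (u + v) x"
      using x by (simp add: proj_product_action[OF \<Phi> x] action_add[OF \<Phi>] proj_in_K product_action_def[of _ "u + v"])
    finally show ?thesis by simp
  qed
qed (simp add: product_action_def)

text \<open>
  This is the step from factor to conjugate: the projection reads its first \<open>n\<close> digits at
  \<open>n\<close> distinct positions, and the injection of \<open>{..<n}\<close> onto these extends to a permutation
  because both complements are countably infinite.
\<close>

lemma relabel_agrees_with_proj:
  obtains \<sigma> where "bij \<sigma>" "\<And>z. z \<in> K \<Longrightarrow> agree n (relabel \<sigma> z) (proj k z)"
proof -
  define f where "f i = prod_encode (k, i)" for i
  have f: "inj f" by (auto simp: f_def inj_on_def)
  have inf: "infinite (- {..<n})" "infinite (- f ` {..<n})"
    by (simp_all add: Compl_eq_Diff_UNIV)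
  obtain g where g: "bij_betw g (- {..<n}) (- f ` {..<n})"
    using inf by (meson bij_betw_inv bij_betw_trans bij_betw_from_nat_into countableI_type)
  define \<sigma> where "\<sigma> i = (if i \<in> {..<n} then f i else g i)" for i
  have "bij_betw \<sigma> ({..<n} \<union> - {..<n}) (f ` {..<n} \<union> - f ` {..<n})"
    unfolding \<sigma>_def using g f
    by (intro bij_betw_disjoint_Un) (auto simp: inj_on_imp_bij_betw inj_on_subset)
  then have "bij \<sigma>" by (metis Compl_partition)
  moreover have "agree n (relabel \<sigma> z) (proj k z)" if "z \<in> K" for z
    using that by (simp add: agree_def proj_def digit_relabel \<sigma>_def f_def)
  ultimately show ?thesis using that by blast
qed

text \<open>
  The lists are the names of the length-\<open>n\<close> cylinders containing \<open>x\<close> and \<open>\<phi> u x\<close>. The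
  group element is part of each entry, so that one set records the transitions of all \<open>u \<in> F\<close>.
\<close>

definition pattern :: "'g set \<Rightarrow> nat \<Rightarrow> ('g \<Rightarrow> 'a \<Rightarrow> 'a) \<Rightarrow> ('g \<times> bool list \<times> bool list) set" where
  "pattern F n \<phi> = (\<lambda>(u, x). (u, map (e x) [0..<n], map (e (\<phi> u x)) [0..<n])) ` (F \<times> K)"

lemma finite_pattern:
  assumes "finite F" shows "finite (pattern F n \<phi>)"
proof (rule finite_subset)
  let ?L = "{xs :: bool list. set xs \<subseteq> UNIV \<and> length xs = n}"
  show "pattern F n \<phi> \<subseteq> F \<times> ?L \<times> ?L" by (auto simp: pattern_def)
  show "finite (F \<times> ?L \<times> ?L)"
    using assms by (intro finite_cartesian_product finite_lists_length_eq) auto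
qed

lemma same_pattern:
  assumes "pattern F n \<phi> = pattern F n \<psi>" "u \<in> F" "x \<in> K"
  obtains y where "y \<in> K" "agree n y x" "agree n (\<psi> u y) (\<phi> u x)"
proof -
  have "(u, map (e x) [0..<n], map (e (\<phi> u x)) [0..<n]) \<in> pattern F n \<psi>"
    using assms(2,3) unfolding assms(1)[symmetric] by (force simp: pattern_def)
  then show ?thesis
    using that by (auto simp: pattern_def agree_def)
qed

text \<open>
  A pattern is a finite subset of a countable type, so for each of the countably many pairs
  \<open>(F, n)\<close> only countably many patterns occur, and one action is picked for each.
\<close>

lemma countable_pattern_representatives:
  obtains D :: "('g::{ab_group_add,countable} \<Rightarrow> 'a \<Rightarrow> 'a) set"
  where "countable D" "D \<subseteq> actions K"
    and "\<forall>F n. finite F \<longrightarrow> (\<forall>\<psi>\<in>actions K. \<exists>\<phi>\<in>D. pattern F n \<phi> = pattern F n \<psi>)"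
proof -
  have "\<exists>D \<subseteq> actions K. countable D \<and> pattern F n ` actions K = pattern F n ` D"
    if "finite F" for F :: "'g set" and n
  proof -
    have "pattern F n ` actions K \<subseteq> {S. finite S}"
      using finite_pattern[OF that] by auto
    then have "countable (pattern F n ` actions K)"
      using countable_Collect_finite countable_subset by blast
    then show ?thesis
      using countable_image_eq[of "pattern F n" "actions K"] by metis
  qed
  then obtain D :: "'g set \<Rightarrow> nat \<Rightarrow> ('g \<Rightarrow> 'a \<Rightarrow> 'a) set"
    where D: "\<And>F n. finite F \<Longrightarrow> D F n \<subseteq> actions K" "\<And>F n. finite F \<Longrightarrow> countable (D F n)"
      "\<And>F n. finite F \<Longrightarrow> pattern F n ` actions K = pattern F n ` D F n"
    by metis
  let ?D = "\<Union>F\<in>{F. finite F}. \<Union>n. D F n"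
  show ?thesis
  proof (rule that[of ?D])
    show "countable ?D"
      using D(2) countable_Collect_finite by (intro countable_UN) auto
    show "?D \<subseteq> actions K" using D(1) by auto
    show "\<forall>F n. finite F \<longrightarrow> (\<forall>\<psi>\<in>actions K. \<exists>\<phi>\<in>?D. pattern F n \<phi> = pattern F n \<psi>)"
    proof (intro allI impI ballI)
      fix F :: "'g set" and n and \<psi> :: "'g \<Rightarrow> 'a \<Rightarrow> 'a"
      assume F: "finite F" and \<psi>: "\<psi> \<in> actions K"
      have "pattern F n \<psi> \<in> pattern F n ` D F n"
        using D(3)[OF F, of n] \<psi> by blast
      then obtain \<phi> where "\<phi> \<in> D F n" "pattern F n \<phi> = pattern F n \<psi>"
        by (metis imageE)
      then show "\<exists>\<phi>\<in>?D. pattern F n \<phi> = pattern F n \<psi>" using F by blast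
    qed
  qed
qed

text \<open>
  Given \<open>\<psi>\<close>, let \<open>\<Phi> k\<close> have the same pattern as \<open>\<psi>\<close>, and let \<open>\<pi>\<close> be close to the
  \<open>k\<close>-th projection \<open>p\<close>. Then \<open>\<pi> (P u z)\<close> is close to \<open>p (P u z) = \<Phi> k u (p z)\<close>,
  which by equality of patterns is close to \<open>\<psi> u y\<close> for some \<open>y\<close> close to \<open>p z\<close>, hence to
  \<open>\<pi> z\<close>; uniform continuity of \<open>\<psi> u\<close> brings \<open>\<psi> u y\<close> close to \<open>\<psi> u (\<pi> z)\<close>.
\<close>

theorem weak_topological_Rohlin:
  "weak_topological_Rohlin K TYPE('g::{ab_group_add,countable})"
proof -
  obtain D :: "('g \<Rightarrow> 'a \<Rightarrow> 'a) set" where D: "countable D" "D \<subseteq> actions K"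
      "\<forall>F n. finite F \<longrightarrow> (\<forall>\<psi>\<in>actions K. \<exists>\<phi>\<in>D. pattern F n \<phi> = pattern F n \<psi>)"
    by (rule countable_pattern_representatives)
  have "continuous_on K (restrict id K)"
    by (rule continuous_on_eq[OF continuous_on_id]) simp
  then have "(\<lambda>u. restrict id K) \<in> actions K"
    by (intro actionsI) auto
  \<comment> \<open>The trivial action has some pattern, so there is a representative to enumerate.\<close>
  then have "D \<noteq> {}" using D(3) finite.emptyI by blast
  define \<Phi> where "\<Phi> = from_nat_into D"
  have \<Phi>: "\<Phi> k \<in> actions K" for k
    using D(2) from_nat_into[OF \<open>D \<noteq> {}\<close>] by (auto simp: \<Phi>_def)
  define P where "P = product_action \<Phi>"
  have P: "P \<in> actions K" unfolding P_def by (rule product_action_in_actions[OF \<Phi>])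
  have "\<exists>\<theta>\<in>conjugacy_class K P. \<theta> \<in> T"
    if \<psi>: "\<psi> \<in> actions K" and T: "openin (action_topology K) T" "\<psi> \<in> T" for \<psi> T
  proof -
    obtain F \<epsilon> where F: "finite F" "\<epsilon> > 0" "\<And>\<theta>. \<theta> \<in> actions K \<Longrightarrow>
        (\<And>u x. u \<in> F \<Longrightarrow> x \<in> K \<Longrightarrow> dist (\<psi> u x) (\<theta> u x) < \<epsilon>) \<Longrightarrow> \<theta> \<in> T"
      using action_topology_nbhd[OF compact_K K_nonempty T] by blast
    have "\<exists>\<delta>>0. \<forall>x\<in>K. \<forall>y\<in>K. dist x y < \<delta> \<longrightarrow> dist (\<psi> u x) (\<psi> u y) < \<epsilon> / 2" for u
      using compact_uniformly_continuous[OF homeo_props(1)[OF action_homeos[OF \<psi>]] compact_K, of u]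
        F(2) unfolding uniformly_continuous_on_def by (metis dist_commute half_gt_zero)
    then obtain \<delta> where \<delta>: "\<And>u. \<delta> u > 0"
        "\<And>u x y. x \<in> K \<Longrightarrow> y \<in> K \<Longrightarrow> dist x y < \<delta> u \<Longrightarrow> dist (\<psi> u x) (\<psi> u y) < \<epsilon> / 2"
      by metis
    \<comment> \<open>Precision enough both for the target points and, through \<open>\<delta>\<close>, for the arguments of \<open>\<psi> u\<close>.\<close>
    define r where "r = Min (insert (\<epsilon> / 2) (\<delta> ` F))"
    have "r > 0"
      using F(1,2) \<delta>(1) by (simp add: r_def)
    moreover have "r \<le> \<epsilon> / 2" "\<And>u. u \<in> F \<Longrightarrow> r \<le> \<delta> u"
      unfolding r_def using F(1) by (intro Min_le; simp)+
    ultimately have r: "r > 0" "r \<le> \<epsilon> / 2" "\<And>u. u \<in> F \<Longrightarrow> r \<le> \<delta> u" .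
    obtain n where n: "\<And>x y. x \<in> K \<Longrightarrow> y \<in> K \<Longrightarrow> agree n x y \<Longrightarrow> dist x y < r"
      using agree_imp_close[OF r(1)] by blast
    obtain \<phi> where "\<phi> \<in> D" "pattern F n \<phi> = pattern F n \<psi>"
      using D(3) F(1) \<psi> by blast
    then obtain k where k: "pattern F n (\<Phi> k) = pattern F n \<psi>"
      using from_nat_into_surj[OF D(1)] unfolding \<Phi>_def by metis
    obtain \<sigma> where \<sigma>: "bij \<sigma>" "\<And>z. z \<in> K \<Longrightarrow> agree n (relabel \<sigma> z) (proj k z)"
      using relabel_agrees_with_proj by blast
    define \<pi> where "\<pi> = relabel \<sigma>"
    have \<pi>: "\<pi> \<in> homeos K" unfolding \<pi>_def by (rule relabel_in_homeos[OF \<sigma>(1)])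
    have P_in: "\<And>u z. z \<in> K \<Longrightarrow> P u z \<in> K" using homeo_props(2)[OF action_homeos[OF P]] .
    have \<psi>_in: "\<And>u z. z \<in> K \<Longrightarrow> \<psi> u z \<in> K" using homeo_props(2)[OF action_homeos[OF \<psi>]] .
    have close: "dist (\<psi> u (\<pi> z)) (\<pi> (P u z)) < \<epsilon>" if u: "u \<in> F" and z: "z \<in> K" for u z
    proof -
      obtain y where y: "y \<in> K" "agree n y (proj k z)" "agree n (\<psi> u y) (\<Phi> k u (proj k z))"
        using same_pattern[OF k u proj_in_K[OF z]] by blast
      have "agree n (\<pi> z) y" "agree n (\<psi> u y) (\<pi> (P u z))"
        using y(2,3) \<sigma>(2)[OF z] \<sigma>(2)[OF P_in[OF z]] proj_product_action[OF \<Phi> z]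
        by (auto simp: agree_def \<pi>_def P_def)
      then have "dist (\<pi> z) y < r" "dist (\<psi> u y) (\<pi> (P u z)) < r"
        using y(1) z by (auto intro!: n simp: P_in \<psi>_in homeo_props(2)[OF \<pi>])
      moreover from this have "dist (\<psi> u (\<pi> z)) (\<psi> u y) < \<epsilon> / 2"
        using r(3)[OF u] y(1) z by (intro \<delta>(2)) (auto simp: homeo_props(2)[OF \<pi>])
      ultimately show ?thesis
        using r(2) dist_triangle[of "\<psi> u (\<pi> z)" "\<pi> (P u z)" "\<psi> u y"] by linarith
    qed
    let ?\<theta> = "\<lambda>u. compose K \<pi> (compose K (P u) (homeo_inv K \<pi>))"
    have "?\<theta> \<in> T"
    proof (rule F(3))
      show "?\<theta> \<in> actions K" by (rule conjugate_in_actions[OF P \<pi>])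
      show "dist (\<psi> u x) (?\<theta> u x) < \<epsilon>" if "u \<in> F" "x \<in> K" for u x
        using close[OF that(1) homeo_props(3)[OF \<pi> that(2)]] homeo_props(5)[OF \<pi> that(2)] that(2)
        by (simp add: compose_def homeo_props(3)[OF \<pi>])
    qed
    moreover have "?\<theta> \<in> conjugacy_class K P"
      using \<pi> by (auto simp: conjugacy_class_def)
    ultimately show ?thesis by blast
  qed
  then have "action_topology K closure_of conjugacy_class K P = actions K"
    by (auto simp: closure_of_def topspace_action_topology[OF compact_K])
  then show ?thesis
    using P by (auto simp: weak_topological_Rohlin_def)
qed

end

section \<open>The middle-thirds set\<close>

definition cantor_point :: "(nat \<Rightarrow> bool) \<Rightarrow> real" where
  "cantor_point a = (\<Sum>n. (if a n then 2 else 0) / 3 ^ Suc n)"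

lemma sums_thirds_tail: "(\<lambda>i. 2 / 3 ^ Suc (i + n)) sums (1 / 3 ^ n :: real)"
proof -
  have "(\<lambda>i. (2 / 3 ^ Suc n) * (1 / 3) ^ i) sums ((2 / 3 ^ Suc n) * (1 / (1 - 1 / 3)) :: real)"
    by (intro sums_mult geometric_sums) simp
  moreover have "(2 / 3 ^ Suc n) * (1 / 3) ^ i = (2 / 3 ^ Suc (i + n) :: real)" for i
    by (simp add: power_add power_one_over)
  moreover have "(2 / 3 ^ Suc n) * (1 / (1 - 1 / 3)) = (1 / 3 ^ n :: real)"
    by simp
  ultimately show ?thesis by (simp only:)
qed

lemma summable_cantor: "summable (\<lambda>n. (if a n then 2 else 0) / 3 ^ Suc n :: real)"
  by (rule summable_comparison_test'[where g = "\<lambda>n. 2 / 3 ^ Suc n" and N = 0])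
    (use sums_thirds_tail[of 0] in \<open>auto simp: sums_iff\<close>)

text \<open>
  Two sequences agreeing below \<open>n\<close> lie in a common middle-thirds interval of length
  \<open>1 / 3 ^ n\<close>. This gives continuity of the coding, and, as \<open>1 / 3 ^ Suc n\<close> is less than the
  weight of digit \<open>n\<close>, also its injectivity.
\<close>

lemma cantor_point_dist_le:
  assumes "\<And>i. i < n \<Longrightarrow> a i = b i"
  shows "\<bar>cantor_point a - cantor_point b\<bar> \<le> 1 / 3 ^ n"
proof -
  let ?f = "\<lambda>a i. (if a i then 2 else 0) / 3 ^ Suc i :: real"
  have split: "cantor_point c = (\<Sum>i. ?f c (i + n)) + (\<Sum>i<n. ?f c i)" for c
    unfolding cantor_point_def by (rule suminf_split_initial_segment[OF summable_cantor])
  have tail: "0 \<le> (\<Sum>i. ?f c (i + n))" "(\<Sum>i. ?f c (i + n)) \<le> 1 / 3 ^ n" for c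
  proof -
    have s: "summable (\<lambda>i. ?f c (i + n))"
      using summable_cantor[of c] summable_ignore_initial_segment by blast
    then show "0 \<le> (\<Sum>i. ?f c (i + n))"
      by (intro suminf_nonneg) auto
    have "(\<Sum>i. ?f c (i + n)) \<le> (\<Sum>i. 2 / 3 ^ Suc (i + n))"
      using s sums_thirds_tail[of n] by (intro suminf_le) (auto simp: sums_iff)
    then show "(\<Sum>i. ?f c (i + n)) \<le> 1 / 3 ^ n"
      using sums_thirds_tail[of n] by (simp add: sums_iff)
  qed
  have "(\<Sum>i<n. ?f a i) = (\<Sum>i<n. ?f b i)"
    using assms by (intro sum.cong) auto
  then show ?thesis
    using split[of a] split[of b] tail[of a] tail[of b] by linarith
qed

lemma inj_cantor_point: "inj cantor_point"
proof (rule injI, rule ccontr)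
  fix a b assume eq: "cantor_point a = cantor_point b" and "a \<noteq> b"
  define n where "n = (LEAST i. a i \<noteq> b i)"
  have "\<exists>i. a i \<noteq> b i" using \<open>a \<noteq> b\<close> unfolding fun_eq_iff not_all .
  from LeastI_ex[OF this] have n: "a n \<noteq> b n"
    unfolding n_def .
  have below_n: "a i = b i" if "i < n" for i
    using not_less_Least[OF that[unfolded n_def]] by simp
  \<comment> \<open>Flipping digit \<open>n\<close> of \<open>a\<close> moves the point further than the later digits can undo.\<close>
  have flip: "\<bar>cantor_point c - cantor_point (c(n := \<not> c n))\<bar> = 2 / 3 ^ Suc n" for c
  proof -
    let ?c = "c(n := \<not> c n)"
    let ?d = "(if c n then 2 else -2) / 3 ^ Suc n :: real"
    have "(\<lambda>i. (if c i then 2 else 0) / 3 ^ Suc i - (if ?c i then 2 else 0) / 3 ^ Suc i) sums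
        (cantor_point c - cantor_point ?c)"
      unfolding cantor_point_def by (intro sums_diff summable_sums summable_cantor)
    moreover have "(if c i then 2 else 0) / 3 ^ Suc i - (if ?c i then 2 else 0) / 3 ^ Suc i =
        (if i = n then ?d else 0)" for i
      by simp
    ultimately have "(\<lambda>i. if i = n then ?d else 0) sums (cantor_point c - cantor_point ?c)"
      by (simp only:)
    then have "cantor_point c - cantor_point ?c = ?d"
      using sums_unique2 sums_single[of n "\<lambda>_. ?d"] by blast
    then show ?thesis by simp
  qed
  have "\<bar>cantor_point (a(n := \<not> a n)) - cantor_point b\<bar> \<le> 1 / 3 ^ Suc n"
    using n below_n by (intro cantor_point_dist_le) (auto simp: less_Suc_eq)
  with flip[of a] eq have "2 / 3 ^ Suc n \<le> (1 / 3 ^ Suc n :: real)" by simp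
  then show False by (simp add: divide_simps)
qed

lemma continuous_cantor_point: "continuous_on UNIV cantor_point"
proof (rule continuous_on_topological[THEN iffD2], intro ballI allI impI)
  fix a B assume B: "open B" "cantor_point a \<in> B"
  then obtain \<epsilon> where \<epsilon>: "\<epsilon> > 0" "\<And>y. \<bar>y - cantor_point a\<bar> < \<epsilon> \<Longrightarrow> y \<in> B"
    by (auto simp: open_dist dist_real_def)
  obtain n where n: "(1 / 3) ^ n < \<epsilon>"
    using real_arch_pow_inv[OF \<epsilon>(1), of "1 / 3"] by auto
  let ?A = "{b. \<forall>i\<in>{..<n}. b i = a i}"
  have "open ?A"
  proof -
    have "open {b. b i = a i}" for i
      using open_vimage[OF open_discrete[of "{a i}"] continuous_on_product_coordinates[of i]]
      by (simp add: vimage_def)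
    then have "open (\<Inter>i\<in>{..<n}. {b. b i = a i})" by (intro open_INT) auto
    also have "(\<Inter>i\<in>{..<n}. {b. b i = a i}) = ?A" by auto
    finally show ?thesis .
  qed
  moreover have "cantor_point b \<in> B" if "b \<in> ?A" for b
    using that n cantor_point_dist_le[of n b a] by (intro \<epsilon>(2)) (auto simp: power_divide)
  ultimately show "\<exists>A. open A \<and> a \<in> A \<and> (\<forall>y\<in>UNIV. y \<in> A \<longrightarrow> cantor_point y \<in> B)"
    by blast
qed

lemma range_cantor_point: "range cantor_point = cantor_set"
proof (intro equalityI subsetI)
  fix x assume "x \<in> range cantor_point"
  then obtain a where a: "x = cantor_point a" by auto
  have "(\<lambda>n. (if a n then 2 else 0) / 3 ^ Suc n) sums x"
    unfolding a cantor_point_def by (rule summable_sums[OF summable_cantor])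
  then show "x \<in> cantor_set"
    unfolding cantor_set_def by (intro CollectI exI[of _ "\<lambda>n. if a n then 2 else 0"]) auto
next
  fix x assume "x \<in> cantor_set"
  then obtain a where a: "\<And>n. a n \<in> {0, 2}" "(\<lambda>n. a n / 3 ^ Suc n) sums x"
    by (auto simp: cantor_set_def)
  have "(if a n = 2 then 2 else 0) = a n" for n using a(1)[of n] by auto
  then have "x = cantor_point (\<lambda>n. a n = 2)"
    using a(2) by (simp add: cantor_point_def sums_iff)
  then show "x \<in> range cantor_point" by blast
qed

theorem proposition3:
  assumes "CARD('d::finite) \<ge> 2"
  shows "weak_topological_Rohlin cantor_set TYPE(int ^ 'd)"
proof -
  obtain e where "homeomorphism UNIV cantor_set cantor_point e"
    using homeomorphism_compact[OF compact_binary_sequences continuous_cantor_point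
        range_cantor_point inj_cantor_point] by blast
  then interpret cantor_coding cantor_set cantor_point e
    by unfold_locales
  show ?thesis
    by (rule weak_topological_Rohlin)
qed

end
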